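(* Let $A \subset [0,1]$. Then the following conditions are equivalent. (i) There exists a strictly increasing continuous singular function $f:[0,1]\to\mathbb{R}$ such that $f$ has a nonzero finite derivative at each point of $A$. (ii) $A$ is a subset of an $F_{\sigma}$ Lebesgue null set.
   Context: A singular function on an interval is a continuous nonconstant real-valued function whose derivative exists and equals zero at Lebesgue almost every point of the interval. For a function defined on an interval $I$, limits and derivatives are computed with respect to $I$ (so at an endpoint belonging to $I$ the derivative is the one-sided derivative). An $F_\sigma$ set is a countable union of closed sets; a Lebesgue null set is a set of Lebesgue measure zero. *)

theory Defs
  imports "HOL-Analysis.Analysis"
begin

text \<open>
  A function on an interval \<open>I\<close> is given by a total function of which only the values on
  \<open>I\<close> matter. Taking the derivative within \<open>I\<close> makes it one-sided at an endpoint of \<open>I\<close>.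
\<close>

definition singular_on :: "real set \<Rightarrow> (real \<Rightarrow> real) \<Rightarrow> bool" where
  "singular_on I f \<longleftrightarrow>
     continuous_on I f \<and> \<not> f constant_on I \<and>
     (AE x in lebesgue. x \<in> I \<longrightarrow> (f has_real_derivative 0) (at x within I))"

end

theory Submission
  imports Defs
begin

text \<open>
  If \<open>f\<close> has a nonzero derivative at \<open>x\<close>, then \<open>\<bar>f y - f x\<bar> \<ge> \<bar>y - x\<bar> / n\<close> near \<open>x\<close> for some \<open>n\<close>. For fixed \<open>n\<close>
  the points with this property on a neighbourhood of radius \<open>1 / n\<close> form a closed set, which is null
  because it contains no point of derivative zero.

  Conversely, let \<open>S\<close> be the increasing union of closed null sets \<open>K\<^sub>n\<close>. For each \<open>n\<close> there is a
  continuous increasing \<open>g\<^sub>n\<close>, uniformly close to the identity, with \<open>\<bar>g\<^sub>n x - x\<bar> \<le> dist(x, K\<^sub>n)\<^sup>2\<close>, that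
  is locally constant off a closed null set \<open>C\<^sub>n\<close> meeting \<open>S\<close> only inside \<open>K\<^sub>n\<close>: on every cell of a Whitney
  decomposition of the complement of \<open>K\<^sub>n\<close> put a Cantor-like function that increases only on a null set
  avoiding \<open>S\<close>. Thus \<open>g\<^sub>n\<close> has derivative 1 on \<open>K\<^sub>n\<close> and derivative 0 on \<open>S - K\<^sub>n\<close>. With rapidly
  decreasing weights \<open>w\<^sub>n > 0\<close> the function \<open>\<Sum>n. w\<^sub>n g\<^sub>n\<close> can be differentiated term by term on \<open>S\<close>,
  because there the difference quotients are dominated by \<open>2 w\<^sub>n\<close> for large \<open>n\<close>, and almost everywhere,
  by the Borel-Cantelli lemma applied to small neighbourhoods of the sets \<open>C\<^sub>n\<close>.
\<close>

subsection \<open>The Cantor function\<close>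

text \<open>The usual recursion distinguishes the three thirds of the unit interval. Since every
  approximation is 0 to the left of 0 and 1 to the right of 1, averaging two rescaled copies covers
  all cases at once.\<close>

primrec cantor_approx :: "nat \<Rightarrow> real \<Rightarrow> real" where
  "cantor_approx 0 x = max 0 (min 1 x)"
| "cantor_approx (Suc n) x = (cantor_approx n (3 * x) + cantor_approx n (3 * x - 2)) / 2"

text \<open>Recording a stage of the Cantor set by the left endpoints of its intervals gives
  directly the count 2^n that the measure estimate needs.\<close>

primrec cantor_left_endpoints :: "nat \<Rightarrow> real set" where
  "cantor_left_endpoints 0 = {0}"
| "cantor_left_endpoints (Suc n) =
     (\<lambda>a. a / 3) ` cantor_left_endpoints n \<union> (\<lambda>a. (a + 2) / 3) ` cantor_left_endpoints n"

definition cantor_stage :: "nat \<Rightarrow> real set" where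
  "cantor_stage n = (\<Union>a\<in>cantor_left_endpoints n. {a..a + (1/3) ^ n})"

lemma finite_cantor_left_endpoints [simp]: "finite (cantor_left_endpoints n)"
  by (induction n) auto

lemma card_cantor_left_endpoints: "card (cantor_left_endpoints n) \<le> 2 ^ n"
proof (induction n)
  case (Suc n)
  have "card (cantor_left_endpoints (Suc n)) \<le> card (cantor_left_endpoints n) + card (cantor_left_endpoints n)"
    unfolding cantor_left_endpoints.simps
    by (intro order_trans[OF card_Un_le] add_mono card_image_le) auto
  then show ?case using Suc by simp
qed auto

lemma closed_cantor_stage: "closed (cantor_stage n)"
  unfolding cantor_stage_def by (intro closed_UN) auto

lemma cantor_stage_0: "cantor_stage 0 = {0..1}"
  by (simp add: cantor_stage_def)

lemma cantor_stage_Suc_left: "3 * x \<in> cantor_stage n \<Longrightarrow> x \<in> cantor_stage (Suc n)"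
  and cantor_stage_Suc_right: "3 * x - 2 \<in> cantor_stage n \<Longrightarrow> x \<in> cantor_stage (Suc n)"
  unfolding cantor_stage_def by (force simp: field_simps)+

lemma mono_cantor_approx: "x \<le> y \<Longrightarrow> cantor_approx n x \<le> cantor_approx n y"
  by (induction n arbitrary: x y) (auto intro!: divide_right_mono add_mono)

lemma continuous_on_cantor_approx: "continuous_on UNIV (cantor_approx n)"
proof (induction n)
  case 0
  then show ?case by (auto intro!: continuous_intros)
next
  case (Suc n)
  have "continuous_on UNIV (\<lambda>x. cantor_approx n (3 * x))" "continuous_on UNIV (\<lambda>x. cantor_approx n (3 * x - 2))"
    by (intro continuous_on_compose2[OF Suc] continuous_intros; simp)+
  then show ?case by (auto intro!: continuous_intros)
qed

lemma cantor_approx_eq_0: "x \<le> 0 \<Longrightarrow> cantor_approx n x = 0"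
  by (induction n arbitrary: x) auto

lemma cantor_approx_eq_1: "1 \<le> x \<Longrightarrow> cantor_approx n x = 1"
  by (induction n arbitrary: x) auto

text \<open>At most one of \<open>3x\<close> and \<open>3x - 2\<close> lies in the open unit interval, off which all approximations agree.\<close>
lemma cantor_approx_Suc_diff: "\<bar>cantor_approx (Suc n) x - cantor_approx n x\<bar> \<le> (1/2) ^ n"
proof (induction n arbitrary: x)
  case 0
  then show ?case by (auto simp: max_def min_def field_simps)
next
  case (Suc n)
  have eq: "cantor_approx (Suc (Suc n)) x - cantor_approx (Suc n) x =
     ((cantor_approx (Suc n) (3*x) - cantor_approx n (3*x)) +
      (cantor_approx (Suc n) (3*x-2) - cantor_approx n (3*x-2))) / 2"
    by (simp add: field_simps)
  show ?case
  proof (cases "1 \<le> 3 * x")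
    case True
    then show ?thesis using Suc[of "3*x-2"] cantor_approx_eq_1[OF True]
      unfolding eq by (simp del: cantor_approx.simps)
  next
    case False
    then have "3 * x - 2 \<le> 0" by simp
    then show ?thesis using Suc[of "3*x"] cantor_approx_eq_0[of "3*x-2"]
      unfolding eq by (simp del: cantor_approx.simps)
  qed
qed

text \<open>The successive differences are bounded by a geometric series, so the approximations
  converge uniformly. The limit inherits the self-similar recursion, which carries local constancy
  from outside the unit interval to the complement of each stage, by induction on the stage.\<close>

lemma cantor_function:
  obtains c :: "real \<Rightarrow> real"
  where "mono c" "continuous_on UNIV c" "\<And>x. x \<le> 0 \<Longrightarrow> c x = 0" "\<And>x. 1 \<le> x \<Longrightarrow> c x = 1"
    and "\<And>n x. x \<notin> cantor_stage n \<Longrightarrow> \<forall>\<^sub>F y in nhds x. c y = c x"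
proof -
  define d where "d x = (\<Sum>n. cantor_approx (Suc n) x - cantor_approx n x)" for x
  define c where "c x = d x + cantor_approx 0 x" for x
  have "uniform_limit UNIV (\<lambda>n x. \<Sum>i<n. cantor_approx (Suc i) x - cantor_approx i x) d sequentially"
    unfolding d_def
    by (rule Weierstrass_m_test[where M="\<lambda>n. (1/2)^n"])
      (use cantor_approx_Suc_diff in \<open>auto simp del: cantor_approx.simps\<close>)
  then have "uniform_limit UNIV (\<lambda>n x. (\<Sum>i<n. cantor_approx (Suc i) x - cantor_approx i x) + cantor_approx 0 x) c sequentially"
    unfolding c_def by (intro uniform_limit_intros)
  then have unif: "uniform_limit UNIV cantor_approx c sequentially"
    by (simp add: sum_lessThan_telescope[of "\<lambda>i. cantor_approx i x" for x] del: cantor_approx.simps)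
  have lim: "(\<lambda>n. cantor_approx n x) \<longlonglongrightarrow> c x" for x
    using tendsto_uniform_limitI[OF unif] by auto
  have c0: "c x = 0" if "x \<le> 0" for x
    using lim[of x] by (simp add: cantor_approx_eq_0[OF that] LIMSEQ_const_iff)
  have c1: "c x = 1" if "1 \<le> x" for x
    using lim[of x] by (simp add: cantor_approx_eq_1[OF that] LIMSEQ_const_iff)
  have rec: "c x = (c (3 * x) + c (3 * x - 2)) / 2" for x
  proof (rule LIMSEQ_unique)
    show "(\<lambda>n. cantor_approx (Suc n) x) \<longlonglongrightarrow> c x"
      using lim LIMSEQ_Suc by blast
    show "(\<lambda>n. cantor_approx (Suc n) x) \<longlonglongrightarrow> (c (3 * x) + c (3 * x - 2)) / 2"
      unfolding cantor_approx.simps by (intro tendsto_intros lim) simp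
  qed
  have const: "\<forall>\<^sub>F y in nhds x. c y = c x" if "x \<notin> cantor_stage n" for n x
    using that
  proof (induction n arbitrary: x)
    case 0
    then consider "x < 0" | "x > 1" by (auto simp: cantor_stage_0)
    then show ?case
    proof cases
      case 1
      then have "\<forall>\<^sub>F y in nhds x. y < 0" by (intro order_tendstoD(2)[OF filterlim_ident]) auto
      then show ?thesis by eventually_elim (use 1 c0 in auto)
    next
      case 2
      then have "\<forall>\<^sub>F y in nhds x. y > 1" by (intro order_tendstoD(1)[OF filterlim_ident]) auto
      then show ?thesis by eventually_elim (use 2 c1 in auto)
    qed
  next
    case (Suc n)
    have "\<forall>\<^sub>F y in nhds x. c (3 * y) = c (3 * x)"
      by (rule eventually_compose_filterlim[OF Suc.IH])
        (use Suc.prems cantor_stage_Suc_left in \<open>auto intro!: tendsto_intros filterlim_ident\<close>)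
    moreover have "\<forall>\<^sub>F y in nhds x. c (3 * y - 2) = c (3 * x - 2)"
      by (rule eventually_compose_filterlim[OF Suc.IH])
        (use Suc.prems cantor_stage_Suc_right in \<open>auto intro!: tendsto_intros filterlim_ident\<close>)
    ultimately show ?case
    proof eventually_elim
      case (elim y)
      then show ?case using rec[of x] rec[of y] by simp
    qed
  qed
  show ?thesis
  proof
    show "mono c"
      by (intro monoI LIMSEQ_le[OF lim lim]) (auto intro: mono_cantor_approx)
    show "continuous_on UNIV c"
      by (rule uniform_limit_theorem[OF _ unif]) (auto intro: continuous_on_cantor_approx always_eventually)
  qed (use c0 c1 const in auto)
qed

subsection \<open>Singular functions growing off a null set\<close>

lemma locally_const_imp_const:
  fixes f :: "real \<Rightarrow> 'a::topological_space"
  assumes "connected I" "\<And>x. x \<in> I \<Longrightarrow> \<forall>\<^sub>F y in nhds x. f y = f x" "x \<in> I" "y \<in> I"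
  shows "f x = f y"
proof -
  have "f constant_on I"
  proof (rule locally_constant_imp_constant[OF assms(1)])
    fix a assume "a \<in> I"
    then obtain U where U: "open U" "a \<in> U" "\<forall>y\<in>U. f y = f a"
      using assms(2)[of a] unfolding eventually_nhds by blast
    then show "\<exists>T. openin (top_of_set I) T \<and> a \<in> T \<and> (\<forall>x\<in>T. f x = f a)"
      using \<open>a \<in> I\<close> openin_open_Int[OF U(1), of I] U(2,3) by (metis Int_iff)
  qed
  then show ?thesis using assms(3,4) unfolding constant_on_def by auto
qed

text \<open>Inner regularity: without the null set the interval keeps its measure
  \<open>b - a\<close>, so a closed subset that misses less than \<open>b - a\<close> of it cannot
  be null.\<close>

lemma compact_positive_measure_avoiding_null:
  fixes S :: "real set"
  assumes "S \<in> null_sets lebesgue" "a < b"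
  obtains Q where "compact Q" "Q \<subseteq> {a<..<b} - S" "0 < measure lebesgue Q"
proof -
  have m: "{a<..<b} - S \<in> lmeasurable"
    using assms by (intro fmeasurable_Diff) auto
  have eq: "emeasure lebesgue ({a<..<b} - S) = ennreal (b - a)"
    using assms by (simp add: emeasure_Diff_null_set)
  obtain T where T: "closed T" "T \<subseteq> {a<..<b} - S" "({a<..<b} - S) - T \<in> lmeasurable"
    "emeasure lebesgue (({a<..<b} - S) - T) < ennreal (b - a)"
    using sets_lebesgue_inner_closed[of "{a<..<b} - S" "b - a"] m assms by (auto simp: fmeasurableD)
  have bd: "bounded T" using T(2) bounded_subset[of "{a<..<b}" T] by auto
  have c: "compact T" using T(1) bd by (simp add: compact_eq_bounded_closed)
  have Tm: "T \<in> lmeasurable" using c by (rule lmeasurable_compact)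
  have "0 < measure lebesgue T"
  proof (rule ccontr)
    assume "\<not> 0 < measure lebesgue T"
    then have "measure lebesgue T = 0" by (simp add: measure_nonneg order.antisym not_less)
    then have "T \<in> null_sets lebesgue" 
      using Tm by (simp add: completion.complete_measure_axioms emeasure_eq_measure2 null_setsI fmeasurableD)
    then have "emeasure lebesgue (({a<..<b} - S) - T) = ennreal (b - a)"
      using eq m by (simp add: emeasure_Diff_null_set fmeasurableD)
    then show False using T by simp
  qed
  then show ?thesis using that c T by blast
qed

text \<open>\<open>F\<close> maps normalised Lebesgue measure on \<open>Q\<close> to the uniform
  distribution on the unit interval. The last clause is the half of this fact that later shows that
  the points of \<open>Q\<close> sent to the Cantor set form a null set.\<close>

lemma normalised_distribution_function:
  fixes Q :: "real set"
  assumes Q: "compact Q" "Q \<subseteq> {a<..<b}" "0 < measure lebesgue Q"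
  obtains F :: "real \<Rightarrow> real"
  where "mono F" "continuous_on UNIV F" "\<And>x. x \<le> a \<Longrightarrow> F x = 0" "\<And>x. b \<le> x \<Longrightarrow> F x = 1"
    and "\<And>x. x \<notin> Q \<Longrightarrow> \<forall>\<^sub>F y in nhds x. F y = F x"
    and "\<And>u v. u \<le> v \<Longrightarrow> measure lebesgue (Q \<inter> F -` {u..v}) \<le> measure lebesgue Q * (v - u)"
proof -
  define q where "q = measure lebesgue Q"
  have q: "q > 0" using Q q_def by simp
  define F where "F x = measure lebesgue (Q \<inter> {..x}) / q" for x
  have Qm: "Q \<in> lmeasurable" using Q by (simp add: lmeasurable_compact)
  have m: "Q \<inter> X \<in> lmeasurable" if "X \<in> sets lebesgue" for X
    using Qm that by (simp add: fmeasurable_Int_fmeasurable)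
  have diff: "F y - F x = measure lebesgue (Q \<inter> {x<..y}) / q" if "x \<le> y" for x y
  proof -
    have "measure lebesgue (Q \<inter> {..y}) = measure lebesgue (Q \<inter> {..x}) + measure lebesgue (Q \<inter> {x<..y})"
      using that fmeasurableD2[OF m, of "{..x}"] fmeasurableD2[OF m, of "{x<..y}"]
        fmeasurableD[OF m, of "{..x}"] fmeasurableD[OF m, of "{x<..y}"]
      by (subst measure_Union[symmetric]) (auto intro!: arg_cong[where f="measure lebesgue"])
    then show ?thesis by (simp add: F_def add_divide_distrib)
  qed
  have mono: "F x \<le> F y" if "x \<le> y" for x y
    using diff[OF that] q by (smt (verit) divide_nonneg_pos measure_nonneg)
  have lip: "F y - F x \<le> (y - x) / q" if "x \<le> y" for x y
  proof -
    have "measure lebesgue (Q \<inter> {x<..y}) \<le> measure lebesgue {x..y}"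
      using fmeasurableD[OF m, of "{x<..y}"] by (intro measure_mono_fmeasurable) auto
    then show ?thesis unfolding diff[OF that] using that q by (simp add: divide_right_mono)
  qed
  have cont: "continuous_on UNIV F"
  proof (rule lipschitz_on_continuous_on[of "1/q"], rule lipschitz_onI)
    fix x y :: real
    show "dist (F x) (F y) \<le> 1/q * dist x y"
      using lip[of x y] lip[of y x] mono[of x y] mono[of y x]
      by (cases "x \<le> y") (auto simp: dist_real_def)
  qed (use q in auto)
  have const_ivl: "F y = F x" if "x \<le> y" "{x<..y} \<inter> Q = {}" for x y
  proof -
    have "Q \<inter> {x<..y} = {}" using that by auto
    then show ?thesis using diff[OF that(1)] by simp
  qed
  show ?thesis
  proof
    show "mono F" by (intro monoI mono)
    show "F x = 0" if "x \<le> a" for x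
    proof -
      have "Q \<inter> {..x} = {}" using Q that by force
      then show ?thesis by (simp add: F_def)
    qed
    show "F x = 1" if "b \<le> x" for x
    proof -
      have "Q \<inter> {..x} = Q" using Q that by force
      then show ?thesis using q by (simp add: F_def q_def)
    qed
    show "\<forall>\<^sub>F y in nhds x. F y = F x" if x: "x \<notin> Q" for x
    proof -
      have "open (- Q)" using Q by (simp add: compact_imp_closed open_Compl)
      then obtain e where e: "e > 0" "ball x e \<subseteq> - Q"
        using x by (meson ComplI openE)
      have "\<forall>\<^sub>F y in nhds x. y \<in> ball x e"
        using e by (intro eventually_nhds_in_open) auto
      then show ?thesis
      proof eventually_elim
        case (elim y)
        have "{x<..y} \<subseteq> ball x e" "{y<..x} \<subseteq> ball x e"
          using elim by (auto simp: dist_real_def)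
        then have "{x<..y} \<inter> Q = {}" "{y<..x} \<inter> Q = {}"
          using e(2) by blast+
        then show ?case using const_ivl[of x y] const_ivl[of y x] by (cases "x \<le> y") auto
      qed
    qed
    show "measure lebesgue (Q \<inter> F -` {u..v}) \<le> measure lebesgue Q * (v - u)" if "u \<le> v" for u v
    proof (cases "Q \<inter> F -` {u..v} = {}")
      case True
      then show ?thesis using that by (simp add: measure_nonneg)
    next
      case False
      have "closed (F -` {u..v})" using cont by (intro closed_vimage) auto
      then have cpt: "compact (Q \<inter> F -` {u..v})" using Q by (simp add: compact_Int_closed)
      \<comment> \<open>All of the compact set lies between its extreme points \<open>s\<close> and
        \<open>t\<close>. Up to the single point \<open>s\<close>, its measure is therefore at most
        that of \<open>Q\<close> in \<open>{s<..t}\<close>, which is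
        \<open>q * (F t - F s)\<close>.\<close>
      obtain s where s: "s \<in> Q \<inter> F -` {u..v}" "\<And>t. t \<in> Q \<inter> F -` {u..v} \<Longrightarrow> s \<le> t"
        using compact_attains_inf[OF cpt False] by auto
      obtain t where t: "t \<in> Q \<inter> F -` {u..v}" "\<And>s. s \<in> Q \<inter> F -` {u..v} \<Longrightarrow> s \<le> t"
        using compact_attains_sup[OF cpt False] by auto
      have st: "s \<le> t" using s t by blast
      have "measure lebesgue (Q \<inter> F -` {u..v}) \<le> measure lebesgue ({s} \<union> (Q \<inter> {s<..t}))"
      proof (rule measure_mono_fmeasurable)
        show "Q \<inter> F -` {u..v} \<subseteq> {s} \<union> (Q \<inter> {s<..t})" using s t by force
        show "Q \<inter> F -` {u..v} \<in> sets lebesgue" using cpt by (simp add: lmeasurable_compact fmeasurableD)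
        show "{s} \<union> (Q \<inter> {s<..t}) \<in> lmeasurable" by (intro fmeasurable.Un m lmeasurable_compact) auto
      qed
      also have "\<dots> \<le> measure lebesgue {s} + measure lebesgue (Q \<inter> {s<..t})"
        using fmeasurableD[OF m, of "{s<..t}"] by (intro measure_Un_le) auto
      also have "\<dots> = q * (F t - F s)" using diff[OF st] q by simp
      also have "\<dots> \<le> q * (v - u)" using s t q by (intro mult_left_mono) auto
      finally show ?thesis by (simp add: q_def)
    qed
  qed (rule cont)
qed

text \<open>The step function is the Cantor function composed with the normalised distribution function of a
  compact set of positive measure that avoids \<open>S\<close>.\<close>
lemma singular_step:
  fixes S :: "real set"
  assumes "S \<in> null_sets lebesgue" "a < b"
  obtains h P where "mono h" "continuous_on UNIV h" "h a = 0" "h b = 1"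
    "closed P" "P \<in> null_sets lebesgue" "P \<subseteq> {a<..<b} - S"
    "\<And>x. x \<notin> P \<Longrightarrow> \<forall>\<^sub>F y in nhds x. h y = (h x :: real)"
proof -
  obtain Q where Q: "compact Q" "Q \<subseteq> {a<..<b} - S" "0 < measure lebesgue Q"
    using compact_positive_measure_avoiding_null[OF assms] .
  have Q2: "Q \<subseteq> {a<..<b}" using Q by auto
  obtain F :: "real \<Rightarrow> real" where F: "mono F" "continuous_on UNIV F" "\<And>x. x \<le> a \<Longrightarrow> F x = 0" "\<And>x. b \<le> x \<Longrightarrow> F x = 1"
    "\<And>x. x \<notin> Q \<Longrightarrow> \<forall>\<^sub>F y in nhds x. F y = F x"
    "\<And>u v. u \<le> v \<Longrightarrow> measure lebesgue (Q \<inter> F -` {u..v}) \<le> measure lebesgue Q * (v - u)"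
    using normalised_distribution_function[OF Q(1) Q2 Q(3)] by blast
  obtain c :: "real \<Rightarrow> real" where c: "mono c" "continuous_on UNIV c" "\<And>x. x \<le> 0 \<Longrightarrow> c x = 0" "\<And>x. 1 \<le> x \<Longrightarrow> c x = 1"
    "\<And>n x. x \<notin> cantor_stage n \<Longrightarrow> \<forall>\<^sub>F y in nhds x. c y = c x"
    using cantor_function by blast
  \<comment> \<open>\<open>F\<close> by itself grows on a set of positive measure. The Cantor
    function confines the growth to the part of \<open>Q\<close> that \<open>F\<close> sends into
    the Cantor set.\<close>
  define P where "P = Q \<inter> F -` (\<Inter>n. cantor_stage n)"
  have "closed (F -` (\<Inter>n. cantor_stage n))"
    using F(2) by (intro closed_vimage) (auto intro: closed_cantor_stage)
  then have P: "compact P" using Q unfolding P_def by (simp add: compact_Int_closed)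
  \<comment> \<open>Stage \<open>n\<close> covers \<open>P\<close> by at most 2^n preimages of
    intervals of length 3^-n, each of which meets \<open>Q\<close> in measure at most 3^-n times
    that of \<open>Q\<close>.\<close>
  have le: "measure lebesgue P \<le> measure lebesgue Q * (2/3)^n" for n
  proof -
    have cl: "closed (F -` {a..a + (1/3)^n})" for a using F(2) by (intro closed_vimage) auto
    then have mm: "Q \<inter> F -` {a..a + (1/3)^n} \<in> lmeasurable" for a 
      using Q by (simp add: compact_Int_closed lmeasurable_compact)
    have "measure lebesgue P \<le> measure lebesgue (\<Union>a\<in>cantor_left_endpoints n. Q \<inter> F -` {a..a + (1/3)^n})"
    proof (rule measure_mono_fmeasurable)
      show "P \<subseteq> (\<Union>a\<in>cantor_left_endpoints n. Q \<inter> F -` {a..a + (1/3)^n})"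
        unfolding P_def by (force simp: cantor_stage_def)
      show "(\<Union>a\<in>cantor_left_endpoints n. Q \<inter> F -` {a..a + (1/3)^n}) \<in> lmeasurable"
        using mm by (intro fmeasurable.finite_UN) auto
    qed (use P in \<open>auto simp: lmeasurable_compact fmeasurableD\<close>)
    also have "\<dots> \<le> (\<Sum>a\<in>cantor_left_endpoints n. measure lebesgue (Q \<inter> F -` {a..a + (1/3)^n}))"
      using mm by (intro measure_UNION_le) (auto simp: fmeasurableD)
    also have "\<dots> \<le> (\<Sum>a\<in>cantor_left_endpoints n. measure lebesgue Q * (1/3)^n)"
      using F(6)[of a "a + (1/3)^n" for a] by (intro sum_mono) auto
    also have "\<dots> = of_nat (card (cantor_left_endpoints n)) * (measure lebesgue Q * (1/3)^n)" by simp
    also have "\<dots> \<le> 2^n * (measure lebesgue Q * (1/3)^n)"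
      using Q(3) of_nat_mono[OF card_cantor_left_endpoints[of n], where 'a=real]
      by (intro mult_right_mono) auto
    finally show ?thesis by (simp add: power_divide field_simps)
  qed
  have "(\<lambda>n. measure lebesgue Q * (2/3)^n) \<longlonglongrightarrow> measure lebesgue Q * 0"
    by (intro tendsto_intros LIMSEQ_power_zero) auto
  then have "measure lebesgue P \<le> 0"
    by (intro LIMSEQ_le_const[where X="\<lambda>n. measure lebesgue Q * (2/3)^n"]) (use le in auto)
  then have P0: "P \<in> null_sets lebesgue"
    using P by (simp add: measure_le_0_iff emeasure_eq_measure2 lmeasurable_compact null_setsI fmeasurableD)
  show ?thesis
  proof
    show "mono (\<lambda>x. c (F x))" using c F by (auto simp: mono_def)
    show "continuous_on UNIV (\<lambda>x. c (F x))" by (rule continuous_on_compose2[OF c(2) F(2)]) auto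
    show "\<forall>\<^sub>F y in nhds x. c (F y) = c (F x)" if x: "x \<notin> P" for x
    proof (cases "x \<in> Q")
      case False
      show ?thesis using F(5)[OF False] by eventually_elim simp
    next
      case True
      then obtain n where "F x \<notin> cantor_stage n" using x P_def by auto
      then have "\<forall>\<^sub>F y in nhds (F x). c y = c (F x)" by (rule c(5))
      moreover have "filterlim F (nhds (F x)) (nhds x)"
        using F(2) by (simp add: continuous_on_eq_continuous_at isCont_def tendsto_nhds_iff)
      ultimately show ?thesis by (rule eventually_compose_filterlim)
    qed
  qed (use P P0 Q c F in \<open>auto simp: compact_imp_closed P_def\<close>)
qed

subsection \<open>Singular approximations of the identity\<close>

text \<open>The cells are the maximal dyadic intervals among those satisfying the size constraints.\<close>
lemma whitney_decomposition:
  fixes K :: "real set"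
  assumes K: "closed K" "K \<noteq> {}" and e: "e > 0"
  obtains J :: "(real \<times> real) set" where "countable J"
    "\<And>a b. (a, b) \<in> J \<Longrightarrow> a < b \<and> b - a \<le> e"
    "\<And>a b x. (a, b) \<in> J \<Longrightarrow> x \<in> {a..b} \<Longrightarrow> b - a \<le> (infdist x K)\<^sup>2"
    "\<And>x. x \<notin> K \<Longrightarrow> \<exists>a b. (a, b) \<in> J \<and> x \<in> {a..<b}"
    "\<And>x a b a' b'. (a, b) \<in> J \<Longrightarrow> (a', b') \<in> J \<Longrightarrow> x \<in> {a..<b} \<Longrightarrow> x \<in> {a'..<b'} \<Longrightarrow> a = a' \<and> b = b'"
    "\<And>x. x \<notin> K \<Longrightarrow> \<exists>r>0. finite {p \<in> J. {fst p..<snd p} \<inter> ball x r \<noteq> {}}"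
proof -
  \<comment> \<open>\<open>l m x\<close> is the left endpoint of the half-open dyadic interval of
    length 2^-m that contains \<open>x\<close>.\<close>
  define l :: "nat \<Rightarrow> real \<Rightarrow> real" where "l m x = of_int \<lfloor>2 ^ m * x\<rfloor> / 2 ^ m" for m x
  define cell where "cell m x = (l m x, l m x + 1 / 2 ^ m)" for m x
  \<comment> \<open>Admissibility is required on the closed interval, right endpoint included. As
    the length is positive, this also keeps the closed cells away from \<open>K\<close>.\<close>
  define G where "G m x \<longleftrightarrow> 1 / 2 ^ m \<le> e \<and>
    (\<forall>z\<in>{l m x..l m x + 1 / 2 ^ m}. 1 / 2 ^ m \<le> (infdist z K)\<^sup>2)" for m x
  \<comment> \<open>The least admissible exponent belongs to the largest admissible dyadic interval
    around \<open>x\<close>.\<close>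
  define N where "N x = (LEAST m. G m x)" for x
  define J where "J = (\<lambda>x. cell (N x) x) ` (- K)"
  have l_le: "l m x \<le> x" and less_l: "x < l m x + 1 / 2 ^ m" for m x
  proof -
    have "of_int \<lfloor>2 ^ m * x\<rfloor> \<le> 2 ^ m * x" "2 ^ m * x < of_int \<lfloor>2 ^ m * x\<rfloor> + 1" by linarith+
    then show "l m x \<le> x" "x < l m x + 1 / 2 ^ m"
      unfolding l_def by (simp_all add: field_simps)
  qed
  have floor_eq: "\<lfloor>2 ^ m * y\<rfloor> = \<lfloor>2 ^ m * x\<rfloor>" if "y \<in> {l m x..<l m x + 1 / 2 ^ m}" for m x y
    using that unfolding l_def by (intro floor_unique) (auto simp: field_simps)
  \<comment> \<open>Dyadic intervals are nested: the index at a coarser level is an integer quotient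
    of the index at a finer level, so points that share a fine interval share every coarser
    one.\<close>
  have l_cong: "l k y = l k x" if "l m y = l m x" "k \<le> m" for k m x y
  proof -
    have "\<lfloor>2 ^ k * z\<rfloor> = \<lfloor>2 ^ m * z\<rfloor> div 2 ^ (m - k)" for z :: real
    proof -
      have "2 ^ k * z = 2 ^ m * z / real_of_int (2 ^ (m - k))"
        using \<open>k \<le> m\<close> power_add[of "2::real" k "m - k"] by simp
      then show ?thesis by (simp only: floor_divide_real_eq_div[of "2 ^ (m - k)"] zero_le_power zero_le_numeral)
    qed
    moreover have "\<lfloor>2 ^ m * y\<rfloor> = \<lfloor>2 ^ m * x\<rfloor>" using that(1) by (simp add: l_def)
    ultimately show ?thesis by (simp add: l_def)
  qed
  have G_cong: "G m y \<longleftrightarrow> G m x" if "l m y = l m x" for m x y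
    using that by (simp add: G_def)
  \<comment> \<open>With \<open>d\<close> the distance from \<open>x\<close> to \<open>K\<close>,
    take the ball of radius \<open>d/4\<close> and a level of length at most \<open>d/4\<close>. The
    intervals of its points stay within \<open>d/2\<close> of \<open>x\<close>, hence at distance at
    least \<open>d/2\<close> from \<open>K\<close>. One level that is admissible on a whole ball
    also yields local finiteness.\<close>
  have G_local: "\<exists>r>0. \<exists>M. \<forall>y\<in>ball x r. G M y" if "x \<notin> K" for x
  proof -
    define d where "d = infdist x K"
    have d: "d > 0" unfolding d_def using that K infdist_pos_not_in_closed by blast
    define t where "t = min e (min ((d/2)\<^sup>2) (d/4))"
    have "t > 0" using d e by (simp add: t_def)
    then obtain M where "(1/2) ^ M < t" using real_arch_pow_inv[of t "1/2"] by auto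
    then have M: "1 / 2 ^ M \<le> e" "1 / 2 ^ M \<le> (d/2)\<^sup>2" "1 / 2 ^ M \<le> d/4"
      by (auto simp: t_def power_one_over)
    have "G M y" if "y \<in> ball x (d/4)" for y
      unfolding G_def
    proof (intro conjI ballI)
      fix z assume z: "z \<in> {l M y..l M y + 1 / 2 ^ M}"
      have "\<bar>z - y\<bar> \<le> 1 / 2 ^ M" using z l_le[of M y] less_l[of y M] by auto
      then have "dist x z \<le> d / 2" using that M unfolding dist_real_def mem_ball by linarith
      then have "d / 2 \<le> infdist z K" using infdist_triangle[of x K z] unfolding d_def by linarith
      then have "(d/2)\<^sup>2 \<le> (infdist z K)\<^sup>2" using d by (intro power_mono) auto
      then show "1 / 2 ^ M \<le> (infdist z K)\<^sup>2" using M by linarith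
    qed (rule M)
    then show ?thesis using d by (intro exI[of _ "d/4"] conjI exI[of _ M] ballI) auto
  qed
  have GN: "G (N x) x" if x: "x \<notin> K" for x
  proof -
    obtain r M where "r > 0" "\<forall>y\<in>ball x r. G M y" using G_local[OF x] by blast
    then have "G M x" by simp
    then show ?thesis unfolding N_def by (rule LeastI)
  qed
  have N_le: "N x \<le> m" if "G m x" for m x
    unfolding N_def using that by (rule Least_le)
  \<comment> \<open>Admissibility depends only on the interval. Hence \<open>y\<close> in the cell
    of \<open>x\<close> has \<open>N y\<close> at most \<open>N x\<close>; by nesting, the possibly
    larger cell of \<open>y\<close> contains \<open>x\<close> and is admissible for it, so
    maximality forces equality.\<close>
  have unique: "cell (N y) y = cell (N x) x"
    if "x \<notin> K" and y: "y \<in> {l (N x) x..<l (N x) x + 1 / 2 ^ N x}" for x y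
  proof -
    have l: "l (N x) y = l (N x) x" using floor_eq[OF y] by (simp add: l_def)
    have G: "G (N x) y" using GN[OF \<open>x \<notin> K\<close>] G_cong[OF l] by simp
    then have le: "N y \<le> N x" by (rule N_le)
    have "G (N y) y" unfolding N_def using G by (rule LeastI)
    then have "G (N y) x" using G_cong[OF l_cong[OF l le]] by simp
    then have "N x \<le> N y" by (rule N_le)
    then show ?thesis using le l by (simp add: cell_def)
  qed
  have cell_eq: "(a, b) = cell (N y) y" if ab: "(a, b) \<in> J" and y: "y \<in> {a..<b}" for a b y
  proof -
    obtain x where x: "x \<notin> K" "(a, b) = cell (N x) x" using ab unfolding J_def by auto
    then have "y \<in> {l (N x) x..<l (N x) x + 1 / 2 ^ N x}" using y by (simp add: cell_def)
    then show ?thesis using unique[OF x(1)] x(2) by simp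
  qed
  show ?thesis
  proof
    have "J \<subseteq> range (\<lambda>(m, k :: int). (of_int k / 2 ^ m, of_int k / 2 ^ m + 1 / 2 ^ m))"
    proof -
      have "cell (N x) x = (\<lambda>(m, k :: int). (of_int k / 2 ^ m, of_int k / 2 ^ m + 1 / 2 ^ m)) (N x, \<lfloor>2 ^ N x * x\<rfloor>)" for x
        by (simp add: cell_def l_def)
      then show ?thesis unfolding J_def by blast
    qed
    then show "countable J" by (rule countable_subset) auto
    show "a < b \<and> b - a \<le> e" if "(a, b) \<in> J" for a b
      using that GN unfolding J_def by (auto simp: cell_def G_def)
    show "b - a \<le> (infdist x K)\<^sup>2" if "(a, b) \<in> J" "x \<in> {a..b}" for a b x
      using that GN unfolding J_def by (auto simp: cell_def G_def)
    show "\<exists>a b. (a, b) \<in> J \<and> x \<in> {a..<b}" if "x \<notin> K" for x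
      using that l_le less_l unfolding J_def cell_def by (auto intro!: exI imageI)
    show "a = a' \<and> b = b'" if "(a, b) \<in> J" "(a', b') \<in> J" "x \<in> {a..<b}" "x \<in> {a'..<b'}" for x a b a' b'
      using cell_eq[OF that(1,3)] cell_eq[OF that(2,4)] by (metis prod.inject)
    show "\<exists>r>0. finite {p \<in> J. {fst p..<snd p} \<inter> ball x r \<noteq> {}}" if x: "x \<notin> K" for x
    proof -
      obtain r M where r: "r > 0" "\<forall>y\<in>ball x r. G M y" using G_local[OF x] by blast
      let ?f = "\<lambda>(m, k :: int). (of_int k / 2 ^ m, of_int k / 2 ^ m + 1 / 2 ^ m :: real)"
      \<comment> \<open>Cells that meet the ball have level at most \<open>M\<close>, and each level
        has only finitely many dyadic intervals near \<open>x\<close>.\<close>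
      have "{p \<in> J. {fst p..<snd p} \<inter> ball x r \<noteq> {}} \<subseteq>
        ?f ` (SIGMA m:{..M}. {\<lfloor>2 ^ m * (x - r)\<rfloor>..\<lfloor>2 ^ m * (x + r)\<rfloor>})"
      proof
        fix p assume "p \<in> {p \<in> J. {fst p..<snd p} \<inter> ball x r \<noteq> {}}"
        then obtain y where y: "p \<in> J" "y \<in> {fst p..<snd p}" "y \<in> ball x r" by blast
        have p: "p = cell (N y) y" using cell_eq[of "fst p" "snd p" y] y by simp
        have "N y \<le> M" using r y by (intro N_le) auto
        moreover have "x - r \<le> y" "y \<le> x + r" using y(3) by (auto simp: dist_real_def)
        ultimately have "(N y, \<lfloor>2 ^ N y * y\<rfloor>) \<in> (SIGMA m:{..M}. {\<lfloor>2 ^ m * (x - r)\<rfloor>..\<lfloor>2 ^ m * (x + r)\<rfloor>})"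
          by (auto intro!: floor_mono mult_left_mono)
        moreover have "p = ?f (N y, \<lfloor>2 ^ N y * y\<rfloor>)" by (simp add: p cell_def l_def)
        ultimately show "p \<in> ?f ` (SIGMA m:{..M}. {\<lfloor>2 ^ m * (x - r)\<rfloor>..\<lfloor>2 ^ m * (x + r)\<rfloor>})"
          by (rule rev_image_eqI)
      qed
      moreover have "finite (?f ` (SIGMA m:{..M}. {\<lfloor>2 ^ m * (x - r)\<rfloor>..\<lfloor>2 ^ m * (x + r)\<rfloor>}))"
        by (intro finite_imageI finite_SigmaI) auto
      ultimately show ?thesis using r(1) finite_subset by blast
    qed
  qed
qed

text \<open>On each Whitney cell \<open>g\<close> is a singular step scaled to climb from one end of
  the cell to the other, and on \<open>K\<close> it is the identity. Every cell is thus mapped into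
  its closure, so the deviation from the identity is at most the cell length, which obeys both
  bounds.\<close>

lemma singular_approximation_of_identity:
  fixes K S :: "real set"
  assumes K: "closed K" "K \<noteq> {}" "K \<in> null_sets lebesgue" and S: "S \<in> null_sets lebesgue" and e: "e > 0"
  obtains g :: "real \<Rightarrow> real" and C where "mono g" "continuous_on UNIV g"
    "\<And>x. \<bar>g x - x\<bar> \<le> e" "\<And>x. \<bar>g x - x\<bar> \<le> (infdist x K)\<^sup>2"
    "closed C" "C \<in> null_sets lebesgue" "K \<subseteq> C" "C \<inter> S \<subseteq> K"
    "\<And>x. x \<notin> C \<Longrightarrow> \<forall>\<^sub>F y in nhds x. g y = g x"
proof -
  obtain J :: "(real \<times> real) set" where J: "countable J"
    "\<And>a b. (a, b) \<in> J \<Longrightarrow> a < b \<and> b - a \<le> e"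
    "\<And>a b x. (a, b) \<in> J \<Longrightarrow> x \<in> {a..b} \<Longrightarrow> b - a \<le> (infdist x K)\<^sup>2"
    "\<And>x. x \<notin> K \<Longrightarrow> \<exists>a b. (a, b) \<in> J \<and> x \<in> {a..<b}"
    "\<And>x a b a' b'. (a, b) \<in> J \<Longrightarrow> (a', b') \<in> J \<Longrightarrow> x \<in> {a..<b} \<Longrightarrow> x \<in> {a'..<b'} \<Longrightarrow> a = a' \<and> b = b'"
    "\<And>x. x \<notin> K \<Longrightarrow> \<exists>r>0. finite {p \<in> J. {fst p..<snd p} \<inter> ball x r \<noteq> {}}"
    by (rule whitney_decomposition[OF K(1,2) e]) (rule that)
  define step where "step a b h P \<longleftrightarrow> mono h \<and> continuous_on UNIV h \<and> h a = 0 \<and> h b = 1 \<and>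
    closed P \<and> P \<in> null_sets lebesgue \<and> P \<subseteq> {a<..<b} - S \<and>
    (\<forall>x. x \<notin> P \<longrightarrow> (\<forall>\<^sub>F y in nhds x. h y = h x))" for a b P and h :: "real \<Rightarrow> real"
  have "\<exists>h P. step a b h P" if "(a, b) \<in> J" for a b
  proof -
    have "a < b" using J(2)[OF that] by simp
    then obtain h P where "mono h" "continuous_on UNIV h" "h a = 0" "h b = 1"
      "closed P" "P \<in> null_sets lebesgue" "P \<subseteq> {a<..<b} - S"
      "\<And>x. x \<notin> P \<Longrightarrow> \<forall>\<^sub>F y in nhds x. h y = (h x :: real)"
      by (rule singular_step[OF S]) (rule that)
    then have "step a b h P" unfolding step_def by blast
    then show ?thesis by blast
  qed
  then obtain h P where "\<And>a b. (a, b) \<in> J \<Longrightarrow> step a b (h a b) (P a b)"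
    by metis
  note hP = this[unfolded step_def]
  obtain \<alpha> \<beta> where \<alpha>\<beta>: "\<And>x. x \<notin> K \<Longrightarrow> (\<alpha> x, \<beta> x) \<in> J \<and> x \<in> {\<alpha> x..<\<beta> x}"
    using J(4) by metis
  define g where "g x = (if x \<in> K then x else \<alpha> x + (\<beta> x - \<alpha> x) * h (\<alpha> x) (\<beta> x) x)" for x
  \<comment> \<open>At a point of \<open>K\<close> the squared distance is 0, which cannot bound the
    positive length of a cell.\<close>
  have disj: "x \<notin> K" if "(a, b) \<in> J" "x \<in> {a..b}" for a b x
    using J(2)[OF that(1)] J(3)[OF that] by (auto simp: infdist_zero)
  have g_cell: "g x = a + (b - a) * h a b x" if "(a, b) \<in> J" "x \<in> {a..<b}" for a b x
  proof -
    have x: "x \<notin> K" using disj that by auto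
    then have "\<alpha> x = a \<and> \<beta> x = b" using J(5)[of "\<alpha> x" "\<beta> x" a b x] \<alpha>\<beta>[OF x] that by auto
    then show ?thesis using x by (simp add: g_def)
  qed
  have g_bounds: "a \<le> g x \<and> g x \<le> b" if "(a, b) \<in> J" "x \<in> {a..<b}" for a b x
  proof -
    have h: "0 \<le> h a b x" "h a b x \<le> 1"
      using hP[OF that(1)] that(2) monoD[of "h a b" a x] monoD[of "h a b" x b] by auto
    have ab: "a < b" using J(2)[OF that(1)] by simp
    have "(b - a) * h a b x \<le> (b - a) * 1" "0 \<le> (b - a) * h a b x"
      using h ab by (intro mult_left_mono mult_nonneg_nonneg; simp)+
    then show ?thesis unfolding g_cell[OF that] by auto
  qed
  have dev: "\<bar>g x - x\<bar> \<le> \<beta> x - \<alpha> x" if "x \<notin> K" for x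
    using g_bounds[of "\<alpha> x" "\<beta> x" x] \<alpha>\<beta>[OF that] by auto
  have mono: "g x \<le> g y" if xy: "x \<le> y" for x y
  proof (cases "x \<in> K"; cases "y \<in> K")
    assume "x \<in> K" "y \<in> K"
    then show ?thesis using xy by (simp add: g_def)
  next
    assume x: "x \<in> K" and y: "y \<notin> K"
    have "x \<le> \<alpha> y" using disj[of "\<alpha> y" "\<beta> y" x] \<alpha>\<beta>[OF y] x xy by force
    then show ?thesis using g_bounds[of "\<alpha> y" "\<beta> y" y] \<alpha>\<beta>[OF y] x by (simp add: g_def)
  next
    assume x: "x \<notin> K" and y: "y \<in> K"
    have "\<beta> x \<le> y" using disj[of "\<alpha> x" "\<beta> x" y] \<alpha>\<beta>[OF x] y xy by force
    moreover have "g y = y" using y by (simp add: g_def)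
    ultimately show ?thesis using g_bounds[of "\<alpha> x" "\<beta> x" x] \<alpha>\<beta>[OF x] by auto
  next
    assume x: "x \<notin> K" and y: "y \<notin> K"
    show ?thesis
    proof (cases "y < \<beta> x")
      case True
      have c: "(\<alpha> x, \<beta> x) \<in> J" "x \<in> {\<alpha> x..<\<beta> x}" "y \<in> {\<alpha> x..<\<beta> x}"
        using \<alpha>\<beta>[OF x] xy True by auto
      have "h (\<alpha> x) (\<beta> x) x \<le> h (\<alpha> x) (\<beta> x) y" using hP[OF c(1)] xy monoD[of "h (\<alpha> x) (\<beta> x)" x y] by blast
      then show ?thesis unfolding g_cell[OF c(1,2)] g_cell[OF c(1,3)]
        using J(2)[OF c(1)] by (simp add: mult_left_mono)
    next
      case False
      \<comment> \<open>Otherwise the larger of the left endpoint of the second cell and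
        \<open>x\<close> would lie in both cells, making them equal, although \<open>y\<close> is
        beyond the first.\<close>
      have "\<beta> x \<le> \<alpha> y"
      proof (rule ccontr)
        assume "\<not> \<beta> x \<le> \<alpha> y"
        then have "max x (\<alpha> y) \<in> {\<alpha> x..<\<beta> x}" "max x (\<alpha> y) \<in> {\<alpha> y..<\<beta> y}"
          using \<alpha>\<beta>[OF x] \<alpha>\<beta>[OF y] xy by auto
        then have "\<beta> x = \<beta> y" using J(5) \<alpha>\<beta>[OF x] \<alpha>\<beta>[OF y] by blast
        then show False using False \<alpha>\<beta>[OF y] by auto
      qed
      then show ?thesis
        using g_bounds[of "\<alpha> x" "\<beta> x" x] \<alpha>\<beta>[OF x] g_bounds[of "\<alpha> y" "\<beta> y" y] \<alpha>\<beta>[OF y] by linarith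
    qed
  qed
  \<comment> \<open>A monotone function onto the line is continuous, so surjectivity replaces any
    gluing of cells at \<open>K\<close>. Inside a cell the intermediate value theorem solves for
    \<open>z\<close>.\<close>
  have "\<exists>x. g x = z" for z
  proof (cases "z \<in> K")
    case True
    then show ?thesis by (auto simp: g_def)
  next
    case False
    define a b where "a = \<alpha> z" and "b = \<beta> z"
    have ab: "(a, b) \<in> J" "z \<in> {a..<b}" using \<alpha>\<beta>[OF False] by (auto simp: a_def b_def)
    have "\<exists>x\<ge>a. x \<le> b \<and> h a b x = (z - a) / (b - a)"
      using ab hP[OF ab(1)] by (intro IVT') (auto intro: continuous_on_subset)
    then obtain x where x: "a \<le> x" "x \<le> b" "h a b x = (z - a) / (b - a)" by blast
    have "x \<noteq> b" using x(3) hP[OF ab(1)] ab(2) by (auto simp: field_simps)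
    then have "g x = z" using x g_cell[of a b x] ab by auto
    then show ?thesis ..
  qed
  then have "range g = UNIV" by (metis surj_def)
  then have cont: "continuous_on UNIV g"
    by (intro continuous_onI_mono mono) auto
  define C where "C = K \<union> (\<Union>(a, b)\<in>J. P a b)"
  \<comment> \<open>By local finiteness a small ball around a point off \<open>K\<close> meets only
    finitely many of the closed sets \<open>P a b\<close>.\<close>
  have "open (- C)"
  proof (subst open_subopen, intro ballI)
    fix x assume x: "x \<in> - C"
    then have "x \<notin> K" by (simp add: C_def)
    then obtain r where r: "r > 0" "finite {p \<in> J. {fst p..<snd p} \<inter> ball x r \<noteq> {}}"
      using J(6) by blast
    define R where "R = {p \<in> J. {fst p..<snd p} \<inter> ball x r \<noteq> {}}"
    define W where "W = ball x r \<inter> - K \<inter> (\<Inter>(a, b)\<in>R. - P a b)"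
    have "open W" unfolding W_def
      using r K(1) hP by (intro open_Int open_INT) (auto simp: R_def)
    moreover have "x \<in> W" using x r(1) by (auto simp: W_def C_def R_def)
    moreover have "W \<subseteq> - C"
    proof
      fix y assume y: "y \<in> W"
      have "y \<notin> P a b" if "(a, b) \<in> J" for a b
      proof
        assume "y \<in> P a b"
        then have "y \<in> {a..<b}" using hP[OF that] by auto
        then have "(a, b) \<in> R" using that y by (auto simp: R_def W_def)
        then show False using y \<open>y \<in> P a b\<close> by (auto simp: W_def)
      qed
      then show "y \<in> - C" using y by (auto simp: C_def W_def)
    qed
    ultimately show "\<exists>T. open T \<and> x \<in> T \<and> T \<subseteq> - C" by blast
  qed
  then have closed: "closed C" by (simp add: closed_def)
  show ?thesis
  proof
    show "mono g" by (intro monoI mono)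
    show "\<bar>g x - x\<bar> \<le> e" for x
      using dev[of x] J(2)[of "\<alpha> x" "\<beta> x"] \<alpha>\<beta>[of x] e by (cases "x \<in> K") (auto simp: g_def)
    show "\<bar>g x - x\<bar> \<le> (infdist x K)\<^sup>2" for x
    proof (cases "x \<in> K")
      case False
      have "\<beta> x - \<alpha> x \<le> (infdist x K)\<^sup>2" using J(3)[of "\<alpha> x" "\<beta> x" x] \<alpha>\<beta>[OF False] by auto
      then show ?thesis using dev[OF False] by linarith
    qed (simp add: g_def)
    show "C \<in> null_sets lebesgue"
      unfolding C_def using K(3) J(1) hP by (intro null_sets.Un null_sets_UN') auto
    show "K \<subseteq> C" by (simp add: C_def)
    show "C \<inter> S \<subseteq> K" unfolding C_def using hP by fast
    show "\<forall>\<^sub>F y in nhds x. g y = g x" if x: "x \<notin> C" for x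
    proof -
      obtain r where r: "r > 0" "ball x r \<subseteq> - C"
        using \<open>open (- C)\<close> x by (meson ComplI openE)
      have const: "g y = g z" if ab: "(a, b) \<in> J" and yz: "y \<in> ball x r \<inter> {a..<b}" "z \<in> ball x r \<inter> {a..<b}" for a b y z
      proof -
        have "h a b y = h a b z"
        proof (rule locally_const_imp_const[OF _ _ yz])
          show "connected (ball x r \<inter> {a..<b})"
            by (intro convex_connected convex_Int) auto
          fix w assume "w \<in> ball x r \<inter> {a..<b}"
          moreover have "P a b \<subseteq> C" using ab by (auto simp: C_def)
          ultimately have "w \<notin> P a b" using r by blast
          then show "\<forall>\<^sub>F y in nhds w. h a b y = h a b w" using hP[OF ab] by blast
        qed
        then show ?thesis using g_cell[OF ab] yz by auto
      qed
      txt \<open>The ball may meet several cells, but a countable connected set of reals has one point.\<close>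
      have "g ` ball x r \<subseteq> (\<Union>(a, b)\<in>J. g ` (ball x r \<inter> {a..<b}))"
      proof
        fix v assume "v \<in> g ` ball x r"
        then obtain y where y: "y \<in> ball x r" "v = g y" by blast
        then have "y \<notin> K" using r by (auto simp: C_def)
        then show "v \<in> (\<Union>(a, b)\<in>J. g ` (ball x r \<inter> {a..<b}))" using \<alpha>\<beta> y by blast
      qed
      moreover have "countable (g ` (ball x r \<inter> {a..<b}))" if ab: "(a, b) \<in> J" for a b
      proof (cases "ball x r \<inter> {a..<b} = {}")
        case False
        then obtain w where "w \<in> ball x r \<inter> {a..<b}" by blast
        then have "g ` (ball x r \<inter> {a..<b}) \<subseteq> {g w}" using const[OF ab] by blast
        then show ?thesis by (rule countable_subset) simp
      qed simp
      ultimately have count: "countable (g ` ball x r)"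
        using J(1) by (elim countable_subset) (auto intro!: countable_UN)
      have conn: "connected (g ` ball x r)"
        using cont by (intro connected_continuous_image) (auto intro: continuous_on_subset)
      have "\<forall>\<^sub>F y in nhds x. y \<in> ball x r"
        using r by (intro eventually_nhds_in_open) auto
      then show ?thesis
      proof eventually_elim
        case (elim y)
        show ?case
        proof (rule ccontr)
          assume "g y \<noteq> g x"
          then have "uncountable (g ` ball x r)"
            using elim r(1) by (intro connected_uncountable[OF conn, of "g y" "g x"]) auto
          then show False using count by simp
        qed
      qed
    qed
  qed (fact cont closed)+
qed

subsection \<open>Superposition\<close>

lemma at_within_Icc_neq_bot:
  fixes x :: real
  assumes "a < b" "x \<in> {a..b}"
  shows "at x within {a..b} \<noteq> bot"
proof -
  have "x islimpt {a..b}"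
    using assms by (intro connected_imp_perfect) auto
  then show ?thesis by (simp add: trivial_limit_within)
qed

text \<open>Tannery's theorem, that is dominated convergence for series, applied to the difference
  quotients. Domination is asked only for large \<open>n\<close>, which is all that the two
  applications can provide.\<close>

lemma has_real_derivative_suminf:
  fixes f :: "nat \<Rightarrow> real \<Rightarrow> real"
  assumes D: "\<And>n. (f n has_real_derivative D n) (at x within T)"
    and sum: "\<And>y. y \<in> T \<Longrightarrow> summable (\<lambda>n. f n y)" and x: "x \<in> T" "at x within T \<noteq> bot"
    and bound: "\<forall>\<^sub>F n in sequentially. \<forall>y\<in>T. \<bar>f n y - f n x\<bar> \<le> M n * \<bar>y - x\<bar>"
    and M: "summable M"
  shows "summable D" "((\<lambda>y. \<Sum>n. f n y) has_real_derivative (\<Sum>n. D n)) (at x within T)"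
proof -
  let ?q = "\<lambda>n y. (f n y - f n x) / (y - x)"
  have T: "\<forall>\<^sub>F y in at x within T. y \<in> T \<and> y \<noteq> x"
    by (auto simp: eventually_at_filter)
  have "norm (?q n y) \<le> M n" if "\<forall>y\<in>T. \<bar>f n y - f n x\<bar> \<le> M n * \<bar>y - x\<bar>" "y \<in> T \<and> y \<noteq> x" for n y
    using that by (simp add: abs_divide pos_divide_le_eq)
  then have "eventually (\<lambda>(n, y). norm (?q n y) \<le> M n) (sequentially \<times>\<^sub>F (at x within T))"
    unfolding eventually_prod_filter using bound T by fast
  then have "summable (\<lambda>n. norm (D n)) \<and> ((\<lambda>y. \<Sum>n. ?q n y) \<longlongrightarrow> (\<Sum>n. D n)) (at x within T)"
    using tannerys_theorem[of ?q D "at x within T" M] D M x(2) unfolding has_field_derivative_iff by blast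
  then have "summable D" and lim: "((\<lambda>y. \<Sum>n. ?q n y) \<longlongrightarrow> (\<Sum>n. D n)) (at x within T)"
    by (auto intro: summable_norm_cancel)
  then show "summable D" by simp
  have "\<forall>\<^sub>F y in at x within T. (\<Sum>n. ?q n y) = ((\<Sum>n. f n y) - (\<Sum>n. f n x)) / (y - x)"
    using T
  proof eventually_elim
    case (elim y)
    then show ?case
      using suminf_divide[OF summable_diff[OF sum sum], of y x "y - x"] suminf_diff[OF sum sum, of y x] x by simp
  qed
  then show "((\<lambda>y. \<Sum>n. f n y) has_real_derivative (\<Sum>n. D n)) (at x within T)"
    unfolding has_field_derivative_iff using lim by (simp add: tendsto_cong)
qed

text \<open>The neighbourhoods of radius \<open>1 / (k + 1)\<close> within the bounded interval
  decrease to the part of \<open>C\<close> in it, because \<open>C\<close> is closed. Continuity of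
  the measure from above then makes their measures tend to 0.\<close>

lemma measure_neighbourhood_null:
  fixes C :: "real set"
  assumes C: "closed C" "C \<noteq> {}" "C \<in> null_sets lebesgue" and e: "e > 0"
  obtains \<delta> where "\<delta> > 0" "measure lebesgue {x \<in> {a..b}. infdist x C \<le> \<delta>} < e"
proof -
  define B where "B k = {x \<in> {a..b}. infdist x C \<le> 1 / real (Suc k)}" for k
  have "B k = {a..b} \<inter> {x. infdist x C \<le> 1 / real (Suc k)}" for k by (auto simp: B_def)
  moreover have "closed {x. infdist x C \<le> 1 / real (Suc k)}" for k
    by (intro closed_Collect_le continuous_intros)
  ultimately have Bm: "B k \<in> lmeasurable" for k
    by (simp add: compact_Int_closed lmeasurable_compact)
  have "(\<Inter>k. B k) = {a..b} \<inter> C"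
  proof
    show "(\<Inter>k. B k) \<subseteq> {a..b} \<inter> C"
    proof
      fix x assume x: "x \<in> (\<Inter>k. B k)"
      then have "\<And>k. infdist x C \<le> 1 / real (Suc k)" by (auto simp: B_def)
      then have "infdist x C \<le> 0"
        by (intro LIMSEQ_le_const[OF LIMSEQ_inverse_real_of_nat]) (auto simp: inverse_eq_divide)
      then have "infdist x C = 0" using infdist_nonneg[of x C] by linarith
      then show "x \<in> {a..b} \<inter> C" using x C by (auto simp: B_def in_closed_iff_infdist_zero)
    qed
  qed (auto simp: B_def)
  moreover have "{a..b} \<inter> C \<in> null_sets lebesgue"
    using C(3) by (rule null_sets_completion_subset[rotated]) auto
  ultimately have "measure lebesgue (\<Inter>k. B k) = 0" by (simp add: null_setsD1 measure_def)
  moreover have "(\<lambda>k. measure lebesgue (B k)) \<longlonglongrightarrow> measure lebesgue (\<Inter>k. B k)"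
  proof (rule Lim_measure_decseq)
    show "decseq B"
    proof (rule decseq_SucI)
      show "B (Suc k) \<subseteq> B k" for k
      proof -
        have "1 / real (Suc (Suc k)) \<le> 1 / real (Suc k)" by (intro divide_left_mono) auto
        then show ?thesis unfolding B_def by auto
      qed
    qed
    show "range B \<subseteq> sets lebesgue" using fmeasurableD[OF Bm] by blast
    show "emeasure lebesgue (B k) \<noteq> \<infinity>" for k using fmeasurableD2[OF Bm] by simp
  qed
  ultimately have "\<forall>\<^sub>F k in sequentially. measure lebesgue (B k) < e"
    using e by (intro order_tendstoD(2)[of _ 0]) auto
  then obtain k where "measure lebesgue (B k) < e"
    by (auto simp: eventually_sequentially)
  then show ?thesis using that[of "1 / real (Suc k)"] by (simp add: B_def)
qed

text \<open>The distance from \<open>y\<close> to \<open>K\<close> is at most that from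
  \<open>y\<close> to \<open>x\<close>, so \<open>g\<close> differs from the identity by at most the
  square of \<open>y - x\<close>, and not at all at \<open>x\<close>.\<close>

lemma has_real_derivative_quadratic_contact:
  fixes g :: "real \<Rightarrow> real"
  assumes "x \<in> K" "\<And>y. \<bar>g y - y\<bar> \<le> (infdist y K)\<^sup>2"
  shows "(g has_real_derivative 1) (at x within T)"
proof -
  have gx: "g x = x" using assms(2)[of x] assms(1) by (simp add: infdist_zero)
  have le: "norm ((g y - g x) / (y - x) - 1) \<le> norm (y - x) * 1" if "y \<noteq> x" for y
  proof -
    have "\<bar>g y - y\<bar> \<le> \<bar>y - x\<bar>\<^sup>2"
      using assms(2)[of y] power_mono[OF infdist_le[OF assms(1), of y] infdist_nonneg, of 2]
      by (simp add: dist_real_def)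
    moreover have "(g y - g x) / (y - x) - 1 = (g y - y) / (y - x)"
      using that gx by (simp add: field_simps)
    ultimately show ?thesis
      using that by (simp add: abs_divide divide_le_eq power2_eq_square)
  qed
  have "((\<lambda>y. y - x) \<longlongrightarrow> 0) (at x within T)"
    by (rule tendsto_eq_intros refl | simp)+
  then have "((\<lambda>y. (g y - g x) / (y - x) - 1) \<longlongrightarrow> 0) (at x within T)"
    by (rule tendsto_0_le[where K=1]) (use le in \<open>auto simp: eventually_at_filter\<close>)
  then show ?thesis unfolding has_field_derivative_iff by (rule LIM_zero_cancel)
qed

lemma has_real_derivative_locally_const:
  fixes g :: "real \<Rightarrow> real"
  assumes "\<forall>\<^sub>F y in nhds x. g y = g x"
  shows "(g has_real_derivative 0) (at x within T)"
proof -
  have "DERIV g x :> 0 \<longleftrightarrow> DERIV (\<lambda>_. g x) x :> 0"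
    by (rule DERIV_cong_ev[OF refl assms refl])
  then have "DERIV g x :> 0" by simp
  then show ?thesis by (rule has_field_derivative_at_within)
qed

section \<open>Necessity: covering the points of nonzero derivative\<close>

lemma nonzero_derivative_set_subset_fsigma_null:
  fixes f :: "real \<Rightarrow> real"
  assumes cont: "continuous_on {0..1} f"
    and AE: "AE x in lebesgue. x \<in> {0..1} \<longrightarrow> (f has_real_derivative 0) (at x within {0..1})"
    and A: "A \<subseteq> {0..1}" "\<And>x. x \<in> A \<Longrightarrow> \<exists>D. D \<noteq> 0 \<and> (f has_real_derivative D) (at x within {0..1})"
  shows "\<exists>S. fsigma S \<and> S \<in> null_sets lebesgue \<and> A \<subseteq> S"
proof -
  \<comment> \<open>The condition on nearby \<open>y\<close> is a disjunction of two non-strict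
    inequalities, so for fixed \<open>y\<close> it is closed in \<open>x\<close>.\<close>
  define E where "E n = {x \<in> {0..1}. \<forall>y\<in>{0..1}. 1 / real (Suc n) \<le> \<bar>y - x\<bar> \<or> \<bar>y - x\<bar> / real (Suc n) \<le> \<bar>f y - f x\<bar>}" for n
  obtain N where N: "{x. \<not> (x \<in> {0..1} \<longrightarrow> (f has_real_derivative 0) (at x within {0..1}))} \<subseteq> N" "N \<in> null_sets lebesgue"
    using AE unfolding eventually_ae_filter by auto
  have closed: "closed (E n)" for n
  proof -
    have "E n = {0..1} \<inter> (\<Inter>y\<in>{0..1}. {x \<in> {0..1}. 1 / real (Suc n) \<le> \<bar>y - x\<bar>} \<union>
      {x \<in> {0..1}. \<bar>y - x\<bar> / real (Suc n) \<le> \<bar>f y - f x\<bar>})"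
      unfolding E_def by blast
    also have "closed \<dots>"
      by (intro closed_Int closed_INT ballI closed_Un continuous_on_closed_Collect_le continuous_intros cont) auto
    finally show ?thesis .
  qed
  have "E n \<subseteq> N" for n
  proof
    fix x assume x: "x \<in> E n"
    \<comment> \<open>Derivative zero would force slopes below \<open>1 / (n + 1)\<close> near
      \<open>x\<close>, against membership in \<open>E n\<close>. The contradiction uses that the
      interval has other points arbitrarily near \<open>x\<close>, even at its ends.\<close>
    have "\<not> (f has_real_derivative 0) (at x within {0..1})"
    proof
      assume "(f has_real_derivative 0) (at x within {0..1})"
      then have "((\<lambda>y. (f y - f x) / (y - x)) \<longlongrightarrow> 0) (at x within {0..1})"
        unfolding has_field_derivative_iff .
      then have "\<forall>\<^sub>F y in at x within {0..1}. dist ((f y - f x) / (y - x)) 0 < 1 / real (Suc n)"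
        by (rule tendstoD) simp
      moreover have "\<forall>\<^sub>F y in at x within {0..1}. dist y x < 1 / real (Suc n)"
        by (rule tendstoD[OF tendsto_ident_at]) simp
      moreover have "\<forall>\<^sub>F y in at x within {0..1}. y \<in> {0..1} \<and> y \<noteq> x"
        by (auto simp: eventually_at_filter)
      ultimately have "\<forall>\<^sub>F y in at x within {0..1}. False"
      proof eventually_elim
        case (elim y)
        then have "\<bar>f y - f x\<bar> < \<bar>y - x\<bar> / real (Suc n)" by (simp add: abs_divide field_simps)
        moreover have "\<bar>y - x\<bar> / real (Suc n) \<le> \<bar>f y - f x\<bar>"
        proof -
          have "1 / real (Suc n) \<le> \<bar>y - x\<bar> \<or> \<bar>y - x\<bar> / real (Suc n) \<le> \<bar>f y - f x\<bar>"
            using x elim(3) unfolding E_def by blast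
          then show ?thesis using elim(2) unfolding dist_real_def by linarith
        qed
        ultimately show False by linarith
      qed
      then show False using at_within_Icc_neq_bot[of 0 1 x] x by (auto simp: E_def eventually_False)
    qed
    then show "x \<in> N" using N(1) x by (auto simp: E_def)
  qed
  then have null: "E n \<in> null_sets lebesgue" for n
    using N(2) null_sets_completion_subset by blast
  have "A \<subseteq> (\<Union>n. E n)"
  proof
    fix x assume x: "x \<in> A"
    then obtain D where D: "D \<noteq> 0" "(f has_real_derivative D) (at x within {0..1})" using A(2) by blast
    have "((\<lambda>y. (f y - f x) / (y - x)) \<longlongrightarrow> D) (at x within {0..1})"
      using D(2) unfolding has_field_derivative_iff .
    then have "\<forall>\<^sub>F y in at x within {0..1}. dist ((f y - f x) / (y - x)) D < \<bar>D\<bar> / 2"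
      by (rule tendstoD) (use D in simp)
    then obtain d where d: "d > 0" "\<And>y. y \<in> {0..1} \<Longrightarrow> y \<noteq> x \<Longrightarrow> dist y x < d \<Longrightarrow> dist ((f y - f x) / (y - x)) D < \<bar>D\<bar> / 2"
      unfolding eventually_at by auto
    \<comment> \<open>One index serves twice: \<open>1 / (n + 1)\<close> is a radius below
      \<open>d\<close> and a slope below half of the absolute value of \<open>D\<close>, which the
      difference quotients near \<open>x\<close> exceed.\<close>
    obtain n where n: "1 / real (Suc n) < min d (\<bar>D\<bar> / 2)"
      using reals_Archimedean[of "min d (\<bar>D\<bar> / 2)"] d D by (auto simp: inverse_eq_divide)
    have "\<bar>y - x\<bar> / real (Suc n) \<le> \<bar>f y - f x\<bar>" if y: "y \<in> {0..1}" "\<bar>y - x\<bar> < 1 / real (Suc n)" for y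
    proof (cases "y = x")
      case False
      have "dist ((f y - f x) / (y - x)) D < \<bar>D\<bar> / 2"
        using d(2)[OF y(1) False] y(2) n by (simp add: dist_real_def)
      then have "1 / real (Suc n) \<le> \<bar>(f y - f x) / (y - x)\<bar>"
        using n unfolding dist_real_def by linarith
      then have "1 / real (Suc n) \<le> \<bar>f y - f x\<bar> / \<bar>y - x\<bar>" by (simp add: abs_divide)
      then show ?thesis using False by (simp add: pos_le_divide_eq)
    qed simp
    then have "x \<in> E n" using x A(1) by (auto simp: E_def simp flip: not_less)
    then show "x \<in> (\<Union>n. E n)" by blast
  qed
  then show ?thesis using closed null fsigma.intros[of E] by blast
qed

section \<open>Sufficiency: the weighted sum of singular approximations\<close>

lemma singular_function_with_nonzero_derivatives:
  fixes S :: "real set"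
  assumes S: "fsigma S" "S \<in> null_sets lebesgue"
  obtains f :: "real \<Rightarrow> real" where "strict_mono_on {0..1} f" "continuous_on {0..1} f"
    "AE x in lebesgue. x \<in> {0..1} \<longrightarrow> (f has_real_derivative 0) (at x within {0..1})"
    "\<And>x. x \<in> S \<inter> {0..1} \<Longrightarrow> \<exists>D. D \<noteq> 0 \<and> (f has_real_derivative D) (at x within {0..1})"
proof -
  obtain F :: "nat \<Rightarrow> real set" where F: "\<And>n. closed (F n)" "S = (\<Union>n. F n)"
    using S(1) by (auto elim: fsigma.cases)
  text \<open>The point 0 only serves to make the sets nonempty, as the distance to the empty set is 0.\<close>
  define K where "K n = insert 0 (\<Union>i\<le>n. F i)" for n
  have K: "closed (K n)" "K n \<noteq> {}" "K n \<in> null_sets lebesgue" for n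
  proof -
    show "closed (K n)" unfolding K_def using F(1) by (intro closed_insert closed_UN) auto
    have "{0} \<union> S \<in> null_sets lebesgue" using S(2) by (intro null_sets.Un) auto
    then show "K n \<in> null_sets lebesgue"
      by (rule null_sets_completion_subset[rotated]) (auto simp: K_def F(2))
  qed (simp add: K_def)
  define approx where "approx n g C \<longleftrightarrow> mono g \<and> continuous_on UNIV g \<and>
    (\<forall>x. \<bar>g x - x\<bar> \<le> (1/2) ^ n) \<and> (\<forall>x. \<bar>g x - x\<bar> \<le> (infdist x (K n))\<^sup>2) \<and>
    closed C \<and> C \<in> null_sets lebesgue \<and> K n \<subseteq> C \<and> C \<inter> S \<subseteq> K n \<and>
    (\<forall>x. x \<notin> C \<longrightarrow> (\<forall>\<^sub>F y in nhds x. g y = g x))" for n and g :: "real \<Rightarrow> real" and C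
  have "\<exists>g C. approx n g C" for n
  proof -
    have "(1/2 :: real) ^ n > 0" by simp
    then obtain g C where "mono g" "continuous_on UNIV g"
      "\<And>x. \<bar>g x - x\<bar> \<le> (1/2) ^ n" "\<And>x. \<bar>g x - x\<bar> \<le> (infdist x (K n))\<^sup>2"
      "closed C" "C \<in> null_sets lebesgue" "K n \<subseteq> C" "C \<inter> S \<subseteq> K n"
      "\<And>x. x \<notin> C \<Longrightarrow> \<forall>\<^sub>F y in nhds x. g y = g x"
      by (rule singular_approximation_of_identity[OF K S(2)]) (rule that)
    then have "approx n g C" unfolding approx_def by blast
    then show ?thesis by blast
  qed
  then obtain g C where "\<And>n. approx n (g n) (C n)" by metis
  then have mono: "mono (g n)" and cont: "continuous_on UNIV (g n)"
    and dev: "\<bar>g n x - x\<bar> \<le> (1/2) ^ n" and contact: "\<bar>g n x - x\<bar> \<le> (infdist x (K n))\<^sup>2"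
    and C: "closed (C n)" "C n \<in> null_sets lebesgue" "K n \<subseteq> C n" "C n \<inter> S \<subseteq> K n"
    and const: "x \<notin> C n \<Longrightarrow> \<forall>\<^sub>F y in nhds x. g n y = g n x" for n x
    unfolding approx_def by blast+
  have "\<exists>\<delta>>0. measure lebesgue {x \<in> {0..1}. infdist x (C n) \<le> \<delta>} < (1/2) ^ n" for n
  proof -
    have "C n \<noteq> {}" "(1/2 :: real) ^ n > 0" using C(3)[of n] K(2)[of n] by auto
    then obtain d where "d > 0" "measure lebesgue {x \<in> {0..1}. infdist x (C n) \<le> d} < (1/2) ^ n"
      by (rule measure_neighbourhood_null[OF C(1) _ C(2)])
    then show ?thesis by blast
  qed
  then obtain \<delta> where \<delta>: "\<And>n. \<delta> n > 0"
    "\<And>n. measure lebesgue {x \<in> {0..1}. infdist x (C n) \<le> \<delta> n} < (1/2) ^ n" by metis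
  text \<open>The factor \<open>\<delta> n\<close> makes the difference quotients of the terms summable at almost every point.\<close>
  define w where "w n = min 1 (\<delta> n) * (1/2) ^ n" for n
  have w: "w n > 0" "w n \<le> (1/2) ^ n" "w n \<le> \<delta> n * (1/2) ^ n" for n
    using \<delta>(1)[of n] by (auto simp: w_def min_def mult_le_cancel_right1)
  have w_diff: "\<bar>w n * g n y - w n * g n x\<bar> = w n * \<bar>g n y - g n x\<bar>" for n x y
    using w(1)[of n] abs_mult[of "w n" "g n y - g n x"] by (simp add: right_diff_distrib)
  define f where "f x = (\<Sum>n. w n * g n x)" for x
  have dev1: "\<bar>g n x - x\<bar> \<le> 1" for n x
    using dev[of n x] power_le_one[of "1/2::real" n] by linarith
  have term_le: "norm (w n * g n x) \<le> 2 * (1/2) ^ n" if "x \<in> {0..1}" for n x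
  proof -
    have "\<bar>g n x\<bar> \<le> 2" using dev1[of n x] that by auto
    then have "w n * \<bar>g n x\<bar> \<le> (1/2) ^ n * 2" using w[of n] by (intro mult_mono) auto
    then show ?thesis using w(1)[of n] by (simp add: abs_mult)
  qed
  have sum2: "summable (\<lambda>n. c * (1/2 :: real) ^ n)" for c by (intro summable_mult summable_geometric) simp
  have summable: "summable (\<lambda>n. w n * g n x)" if "x \<in> {0..1}" for x
    by (rule summable_comparison_test'[OF sum2]) (rule term_le[OF that])
  have "uniform_limit {0..1} (\<lambda>N x. \<Sum>n<N. w n * g n x) f sequentially"
    unfolding f_def by (rule Weierstrass_m_test[OF term_le sum2])
  then have contf: "continuous_on {0..1} f"
    by (rule uniform_limit_theorem[rotated])
      (auto intro!: always_eventually continuous_intros continuous_on_subset[OF cont])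
  have strict: "f a < f b" if ab: "a \<in> {0..1}" "b \<in> {0..1}" "a < b" for a b
  proof -
    have pos: "0 \<le> w n * g n b - w n * g n a" for n
      using monoD[OF mono[of n], of a b] ab w(1)[of n] by (simp add: mult_left_mono)
    \<comment> \<open>Once \<open>g n\<close> moves points by less than half of
      \<open>b - a\<close>, it separates \<open>a\<close> from \<open>b\<close>. This single strict
      term suffices, as all terms are monotone.\<close>
    obtain n where n: "(1/2 :: real) ^ n < (b - a) / 2"
      using real_arch_pow_inv[of "(b - a) / 2" "1/2 :: real"] ab by auto
    have "g n a < g n b" using dev[of n a] dev[of n b] n unfolding abs_le_iff by argo
    then have "0 < w n * g n b - w n * g n a" using w(1)[of n] by simp
    then have "0 < (\<Sum>n. w n * g n b - w n * g n a)"
      using summable_diff[OF summable summable, OF ab(2,1)] pos by (intro suminf_pos2)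
    then show ?thesis unfolding f_def using suminf_diff[OF summable summable, OF ab(2,1)] by simp
  qed
  have deriv_zero: "((\<lambda>x. w n * g n x) has_real_derivative 0) (at x within {0..1})" if "x \<notin> C n" for n x
    using DERIV_cmult[OF has_real_derivative_locally_const[OF const[OF that]], of "w n"] by simp
  show ?thesis
  proof
    show "strict_mono_on {0..1} f" by (intro strict_mono_onI strict)
    show "continuous_on {0..1} f" by (rule contf)
    show "\<exists>D. D \<noteq> 0 \<and> (f has_real_derivative D) (at x within {0..1})" if x: "x \<in> S \<inter> {0..1}" for x
    proof -
      \<comment> \<open>A point of \<open>S\<close> outside \<open>K n\<close> is also outside
        \<open>C n\<close>, where \<open>g n\<close> is locally constant; on \<open>K n\<close> the
        contact with the identity gives slope 1.\<close>
      define D where "D n = (if x \<in> K n then w n else 0)" for n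
      obtain m where m: "x \<in> F m" using x F(2) by auto
      then have Km: "x \<in> K n" if "m \<le> n" for n using that by (auto simp: K_def)
      have D: "((\<lambda>y. w n * g n y) has_real_derivative D n) (at x within {0..1})" for n
      proof (cases "x \<in> K n")
        case True
        then show ?thesis
          using DERIV_cmult[OF has_real_derivative_quadratic_contact[OF True contact], where c="w n"]
          by (simp add: D_def)
      next
        case False
        then have "x \<notin> C n" using C(4) x by blast
        then show ?thesis using deriv_zero False by (simp add: D_def)
      qed
      \<comment> \<open>From \<open>m\<close> on, \<open>x\<close> lies in \<open>K n\<close> and is
        fixed by \<open>g n\<close>. On the unit interval the squared distance is at most the
        distance, so the increments of \<open>g n\<close> are at most twice those of the
        identity.\<close>
      have "\<bar>w n * g n y - w n * g n x\<bar> \<le> 2 * (1/2) ^ n * \<bar>y - x\<bar>" if "m \<le> n" "y \<in> {0..1}" for n y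
      proof -
        have "g n x = x" using contact[of n x] Km[OF that(1)] by (simp add: infdist_zero)
        moreover have "\<bar>g n y - y\<bar> \<le> \<bar>y - x\<bar>"
        proof -
          have "infdist y (K n) \<le> \<bar>y - x\<bar>" using infdist_le[OF Km[OF that(1)], of y] by (simp add: dist_real_def)
          then have "(infdist y (K n))\<^sup>2 \<le> \<bar>y - x\<bar>\<^sup>2" by (intro power_mono infdist_nonneg)
          also have "\<dots> \<le> \<bar>y - x\<bar> * 1" unfolding power2_eq_square using x that(2) by (intro mult_left_mono) auto
          finally show ?thesis using order_trans[OF contact[of n y]] by simp
        qed
        ultimately have "\<bar>g n y - g n x\<bar> \<le> 2 * \<bar>y - x\<bar>"
          using abs_triangle_ineq[of "g n y - y" "y - x"] by simp
        then have "w n * \<bar>g n y - g n x\<bar> \<le> (1/2) ^ n * (2 * \<bar>y - x\<bar>)" using w[of n] by (intro mult_mono) auto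
        then show ?thesis by (simp add: w_diff)
      qed
      then have "\<forall>\<^sub>F n in sequentially. \<forall>y\<in>{0..1}. \<bar>w n * g n y - w n * g n x\<bar> \<le> 2 * (1/2) ^ n * \<bar>y - x\<bar>"
        unfolding eventually_sequentially by blast
      note deriv = has_real_derivative_suminf[OF D summable _ at_within_Icc_neq_bot this sum2]
      have "summable D" "(f has_real_derivative suminf D) (at x within {0..1})"
        using deriv x unfolding f_def by auto
      \<comment> \<open>No term is negative, and the term of index \<open>m\<close> is the positive
        weight \<open>w m\<close>.\<close>
      moreover have "0 < suminf D"
        using \<open>summable D\<close> w(1) Km[of m] by (intro suminf_pos2[of D m]) (auto simp: D_def intro: less_imp_le)
      ultimately show ?thesis by (intro exI[of _ "suminf D"]) auto
    qed
    \<comment> \<open>The measures of these sets are summable, so by Borel-Cantelli almost every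
      point lies in only finitely many of them.\<close>
    define bad where "bad n = {x \<in> {0..1}. infdist x (C n) \<le> \<delta> n}" for n
    have bad_m: "bad n \<in> lmeasurable" for n
    proof -
      have "bad n = {0..1} \<inter> {x. infdist x (C n) \<le> \<delta> n}" by (auto simp: bad_def)
      moreover have "closed {x. infdist x (C n) \<le> \<delta> n}" by (intro closed_Collect_le continuous_intros)
      ultimately show ?thesis by (simp add: compact_Int_closed lmeasurable_compact)
    qed
    have "AE x in lebesgue. \<forall>\<^sub>F n in sequentially. x \<in> space lebesgue - bad n"
    proof (rule borel_cantelli_AE1)
      show "summable (\<lambda>n. measure lebesgue (bad n))"
        by (rule summable_comparison_test'[OF sum2[of 1]]) (use \<delta>(2) in \<open>auto simp: bad_def intro: less_imp_le\<close>)
      show "emeasure lebesgue (bad n) < \<infinity>" for n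
        using fmeasurableD2[OF bad_m] by (simp add: top.not_eq_extremum)
    qed (rule fmeasurableD[OF bad_m])
    moreover have "AE x in lebesgue. \<forall>n. x \<notin> C n"
      using C(2) by (simp add: AE_all_countable AE_not_in)
    ultimately show "AE x in lebesgue. x \<in> {0..1} \<longrightarrow> (f has_real_derivative 0) (at x within {0..1})"
    proof eventually_elim
      case (elim x)
      show ?case
      proof
        assume x: "x \<in> {0..1}"
        \<comment> \<open>If \<open>y\<close> is closer than \<open>\<delta> n\<close>, both points
          lie in a ball that misses \<open>C n\<close>, on which \<open>g n\<close> is constant.
          Otherwise the factor \<open>\<delta> n\<close> in the weight is at most the distance, and
          the increment of \<open>g n\<close> is at most 3: one for the unit interval and one for
          the deviation at each point.\<close>
        have le: "\<bar>w n * g n y - w n * g n x\<bar> \<le> 3 * (1/2) ^ n * \<bar>y - x\<bar>"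
          if n: "x \<notin> bad n" and y: "y \<in> {0..1}" for n y
        proof (cases "\<bar>y - x\<bar> < \<delta> n")
          case True
          have "g n y = g n x"
          proof (rule locally_const_imp_const[where f = "g n" and I = "ball x (\<delta> n)"])
            fix z assume "z \<in> ball x (\<delta> n)"
            then have "z \<notin> C n" using infdist_le[of z "C n" x] n x by (auto simp: bad_def)
            then show "\<forall>\<^sub>F y in nhds z. g n y = g n z" by (rule const)
          qed (use True \<delta>(1)[of n] in \<open>auto simp: dist_real_def\<close>)
          then show ?thesis by simp
        next
          case False
          have "\<bar>g n y - g n x\<bar> \<le> 3" using dev1[of n y] dev1[of n x] x y by auto
          then have "w n * \<bar>g n y - g n x\<bar> \<le> (\<delta> n * (1/2) ^ n) * 3" using w[of n] by (intro mult_mono) auto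
          also have "\<dots> \<le> (\<bar>y - x\<bar> * (1/2) ^ n) * 3" using False by (intro mult_right_mono) auto
          finally show ?thesis by (simp add: w_diff mult_ac)
        qed
        have "\<forall>\<^sub>F n in sequentially. \<forall>y\<in>{0..1}. \<bar>w n * g n y - w n * g n x\<bar> \<le> 3 * (1/2) ^ n * \<bar>y - x\<bar>"
          using elim(1) by eventually_elim (use le in blast)
        note deriv = has_real_derivative_suminf(2)[OF deriv_zero summable _ at_within_Icc_neq_bot this sum2]
        show "(f has_real_derivative 0) (at x within {0..1})"
          using deriv elim(2) x unfolding f_def by auto
      qed
    qed
  qed
qed

section \<open>The equivalence\<close>

theorem theorem1p1:
  fixes A :: "real set"
  assumes "A \<subseteq> {0..1}"
  shows "(\<exists>f :: real \<Rightarrow> real.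
            strict_mono_on {0..1} f \<and> continuous_on {0..1} f \<and> singular_on {0..1} f \<and>
            (\<forall>x\<in>A. \<exists>D. D \<noteq> 0 \<and> (f has_real_derivative D) (at x within {0..1})))
         \<longleftrightarrow> (\<exists>S. fsigma S \<and> S \<in> null_sets lebesgue \<and> A \<subseteq> S)"
proof
  assume "\<exists>f :: real \<Rightarrow> real.
            strict_mono_on {0..1} f \<and> continuous_on {0..1} f \<and> singular_on {0..1} f \<and>
            (\<forall>x\<in>A. \<exists>D. D \<noteq> 0 \<and> (f has_real_derivative D) (at x within {0..1}))"
  then obtain f :: "real \<Rightarrow> real" where "singular_on {0..1} f"
    "\<And>x. x \<in> A \<Longrightarrow> \<exists>D. D \<noteq> 0 \<and> (f has_real_derivative D) (at x within {0..1})"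
    by blast
  then show "\<exists>S. fsigma S \<and> S \<in> null_sets lebesgue \<and> A \<subseteq> S"
    using assms nonzero_derivative_set_subset_fsigma_null[of f A] unfolding singular_on_def by blast
next
  assume "\<exists>S. fsigma S \<and> S \<in> null_sets lebesgue \<and> A \<subseteq> S"
  then obtain S where S: "fsigma S" "S \<in> null_sets lebesgue" "A \<subseteq> S" by blast
  obtain f :: "real \<Rightarrow> real" where f: "strict_mono_on {0..1} f" "continuous_on {0..1} f"
    "AE x in lebesgue. x \<in> {0..1} \<longrightarrow> (f has_real_derivative 0) (at x within {0..1})"
    "\<And>x. x \<in> S \<inter> {0..1} \<Longrightarrow> \<exists>D. D \<noteq> 0 \<and> (f has_real_derivative D) (at x within {0..1})"
    by (rule singular_function_with_nonzero_derivatives[OF S(1,2)]) (rule that)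
  have "f 0 < f 1" using strict_mono_onD[OF f(1), of 0 1] by simp
  then have "\<not> f constant_on {0..1}" by (force simp: constant_on_def)
  then have "singular_on {0..1} f" using f(2,3) by (simp add: singular_on_def)
  then show "\<exists>f :: real \<Rightarrow> real.
            strict_mono_on {0..1} f \<and> continuous_on {0..1} f \<and> singular_on {0..1} f \<and>
            (\<forall>x\<in>A. \<exists>D. D \<noteq> 0 \<and> (f has_real_derivative D) (at x within {0..1}))"
    using f S(3) assms by blast
qed

end
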